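(* Let $(\mathfrak{A},\omega,\tau,K)$ be a compact $C^{\ast}$-dynamical system with $\omega$ a trace. Suppose that $A\in\mathfrak{A}^{+}$ and $\omega(A)>0$. Take any $m_0,\ldots,m_k\in\mathbb{N}\cup\{0\}$. Then there exist a relatively dense set $E$ in $K$ and an $a>0$ such that $$\left|\omega\left(\prod_{j=0}^{k}\tau_{g^{m_j}}(A)\right)\right|>a$$ for all $g\in E$.
   Context: $\mathbb{N}=\{1,2,3,\ldots\}$. For a positive linear functional $\omega$ on a $\ast$-algebra $\mathfrak{A}$ (i.e. $\omega(A^{\ast}A)\geq 0$ for all $A$), $\Vert A\Vert_{\omega}:=\sqrt{\omega(A^{\ast}A)}$, a seminorm on $\mathfrak{A}$. A $\ast$-dynamical system $(\mathfrak{A},\omega,\tau,K)$ consists of a $\ast$-algebra $\mathfrak{A}$, a positive linear functional $\omega$ on it, a semigroup $K$, and linear maps $\tau_g:\mathfrak{A}\to\mathfrak{A}$ ($g\in K$) with $\tau_g\circ\tau_h=\tau_{gh}$ and $\Vert\tau_g(A)\Vert_{\omega}=\Vert A\Vert_{\omega}$ for all $g,h\in K$, $A\in\mathfrak{A}$. It is a $C^{\ast}$-dynamical system if moreover $\mathfrak{A}$ is a $C^{\ast}$-algebra and $\Vert\tau_g(A)\Vert\leq\Vert A\Vert$ in the norm of $\mathfrak{A}$ for all $A\in\mathfrak{A}$, $g\in K$. It is compact if for each $A\in\mathfrak{A}$ the orbit $\{\tau_g(A):g\in K\}$ is totally bounded in $(\mathfrak{A},\Vert\cdot\Vert_{\omega})$.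 (A subset $B$ of a pseudometric space $(X,d)$ is totally bounded if for every $\varepsilon>0$ there is a finite $M_\varepsilon\subset X$ such that every $x\in B$ has some $y\in M_\varepsilon$ with $d(x,y)<\varepsilon$.) $\mathfrak{A}^{+}$ is the set of positive elements of the $C^\ast$-algebra. A trace is a state $\omega$ on a $C^{\ast}$-algebra with $\omega(AB)=\omega(BA)$ for all $A,B$. Convention: $\tau_{g^0}(A):=A$; products $\prod_{j=0}^{k}$ are taken in the order of increasing $j$ from left to right. A subset $E$ of a semigroup $K$ is relatively dense in $K$ if there exist $r\in\mathbb{N}$ and $g_1,\ldots,g_r\in K$ such that $E\cap\{gg_1,\ldots,gg_r\}\neq\varnothing$ for all $g\in K$. *)

theory Defs
  imports "HOL-Analysis.Analysis" "HOL-Library.Complex_Order"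
begin

section \<open>Complex star-algebras and C*-algebras\<close>

text \<open>Algebras are associative, but neither commutativity nor a unit is assumed.\<close>

class star_algebra = ring +
  fixes scaleC :: "complex \<Rightarrow> 'a \<Rightarrow> 'a"  (infixr "*\<^sub>C" 75)
    and star :: "'a \<Rightarrow> 'a"
  assumes scaleC_add_right: "c *\<^sub>C (x + y) = c *\<^sub>C x + c *\<^sub>C y"
    and scaleC_add_left: "(c + d) *\<^sub>C x = c *\<^sub>C x + d *\<^sub>C x"
    and scaleC_scaleC: "c *\<^sub>C (d *\<^sub>C x) = (c * d) *\<^sub>C x"
    and scaleC_one: "1 *\<^sub>C x = x"
    and mult_scaleC_left: "(c *\<^sub>C x) * y = c *\<^sub>C (x * y)"
    and mult_scaleC_right: "x * (c *\<^sub>C y) = c *\<^sub>C (x * y)"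
    and star_add: "star (x + y) = star x + star y"
    and star_scaleC: "star (c *\<^sub>C x) = cnj c *\<^sub>C star x"
    and star_mult: "star (x * y) = star y * star x"
    and star_star: "star (star x) = x"

text \<open>The real scalar multiplication required by the library's class of Banach spaces is
  tied to the complex one; submultiplicativity of the norm is part of
  \<^class>\<open>real_normed_algebra\<close>.\<close>

class cstar_algebra = star_algebra + real_normed_algebra + banach +
  assumes scaleR_scaleC: "r *\<^sub>R x = complex_of_real r *\<^sub>C x"
    and norm_scaleC: "norm (c *\<^sub>C x) = cmod c * norm x"
    and cstar_identity: "norm (star x * x) = (norm x)\<^sup>2"

text \<open>A pair \<open>(c, x)\<close> stands for \<open>c1 + x\<close> in the unitization; its unit is \<open>(1, 0)\<close>.\<close>

definition unitization_mult ::
    "complex \<times> 'a \<Rightarrow> complex \<times> 'a \<Rightarrow> complex \<times> 'a::star_algebra" where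
  "unitization_mult p q =
     (fst p * fst q, fst p *\<^sub>C snd q + fst q *\<^sub>C snd p + snd p * snd q)"

text \<open>The spectrum is taken in the unitization whether or not the algebra has a unit. In a
  unital algebra this adds at most the point 0 to the spectrum taken in the algebra itself,
  which does not affect the notion of a positive element.\<close>

definition cstar_spectrum :: "'a::cstar_algebra \<Rightarrow> complex set" where
  "cstar_spectrum x =
     {c. \<not> (\<exists>q. unitization_mult (c, - x) q = (1, 0) \<and> unitization_mult q (c, - x) = (1, 0))}"

definition positive_elements :: "'a::cstar_algebra set" where
  "positive_elements = {x. star x = x \<and> cstar_spectrum x \<subseteq> {c. 0 \<le> c}}"


section \<open>Positive functionals, states and traces\<close>

text \<open>The order on \<^typ>\<open>complex\<close> is that of \<^theory>\<open>HOL-Library.Complex_Order\<close>: \<open>0 \<le> c\<close> means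
  that \<open>c\<close> is real and nonnegative, and \<open>0 < c\<close> that \<open>c\<close> is real and positive.\<close>

definition positive_functional :: "('a::star_algebra \<Rightarrow> complex) \<Rightarrow> bool" where
  "positive_functional \<omega> \<longleftrightarrow>
     Vector_Spaces.linear scaleC (*) \<omega> \<and> (\<forall>x. 0 \<le> \<omega> (star x * x))"

definition state :: "('a::cstar_algebra \<Rightarrow> complex) \<Rightarrow> bool" where
  "state \<omega> \<longleftrightarrow> positive_functional \<omega> \<and> bounded_linear \<omega> \<and> onorm \<omega> = 1"

definition trace_state :: "('a::cstar_algebra \<Rightarrow> complex) \<Rightarrow> bool" where
  "trace_state \<omega> \<longleftrightarrow> state \<omega> \<and> (\<forall>x y. \<omega> (x * y) = \<omega> (y * x))"

definition functional_seminorm :: "('a::star_algebra \<Rightarrow> complex) \<Rightarrow> 'a \<Rightarrow> real" where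
  "functional_seminorm \<omega> x = sqrt (Re (\<omega> (star x * x)))"


section \<open>Dynamical systems\<close>

text \<open>The library's \<^const>\<open>totally_bounded\<close> refers to the uniformity of a type class, so it does
  not apply to the pseudometric given by a functional.\<close>

definition pseudometric_totally_bounded :: "('a \<Rightarrow> 'a \<Rightarrow> real) \<Rightarrow> 'a set \<Rightarrow> bool" where
  "pseudometric_totally_bounded d B \<longleftrightarrow>
     (\<forall>\<epsilon>>0. \<exists>M. finite M \<and> (\<forall>x\<in>B. \<exists>y\<in>M. d x y < \<epsilon>))"

locale star_dynamical_system =
  fixes \<omega> :: "'a::star_algebra \<Rightarrow> complex"
    and \<tau> :: "'k::semigroup_mult \<Rightarrow> 'a \<Rightarrow> 'a"
  assumes positive_functional: "positive_functional \<omega>"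
    and linear: "Vector_Spaces.linear scaleC scaleC (\<tau> g)"
    and action: "\<tau> g \<circ> \<tau> h = \<tau> (g * h)"
    and seminorm_preserving: "functional_seminorm \<omega> (\<tau> g x) = functional_seminorm \<omega> x"

locale cstar_dynamical_system = star_dynamical_system \<omega> \<tau>
  for \<omega> :: "'a::cstar_algebra \<Rightarrow> complex" and \<tau> :: "'k::semigroup_mult \<Rightarrow> 'a \<Rightarrow> 'a" +
  assumes norm_contractive: "norm (\<tau> g x) \<le> norm x"

definition compact_system ::
    "('a::star_algebra \<Rightarrow> complex) \<Rightarrow> ('k::semigroup_mult \<Rightarrow> 'a \<Rightarrow> 'a) \<Rightarrow> bool" where
  "compact_system \<omega> \<tau> \<longleftrightarrow>
     (\<forall>x. pseudometric_totally_bounded (\<lambda>y z. functional_seminorm \<omega> (y - z))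
            (range (\<lambda>g. \<tau> g x)))"


section \<open>Powers, ordered products and relative density\<close>

text \<open>In a semigroup without identity only positive powers exist: this is \<open>g\<close> to the power
  \<open>n + 1\<close>.\<close>

primrec semigroup_power_Suc :: "'k::semigroup_mult \<Rightarrow> nat \<Rightarrow> 'k" where
  "semigroup_power_Suc g 0 = g"
| "semigroup_power_Suc g (Suc n) = semigroup_power_Suc g n * g"

text \<open>The map written \<open>\<tau>\<close> with index \<open>g\<close> to the power \<open>n\<close>, which by convention is the identity
  for \<open>n = 0\<close>.\<close>

fun action_power :: "('k::semigroup_mult \<Rightarrow> 'a \<Rightarrow> 'a) \<Rightarrow> 'k \<Rightarrow> nat \<Rightarrow> 'a \<Rightarrow> 'a" where
  "action_power \<tau> g 0 x = x"
| "action_power \<tau> g (Suc n) x = \<tau> (semigroup_power_Suc g n) x"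

text \<open>The product of \<open>f 0, \<dots>, f k\<close> in this order from left to right.\<close>

primrec ordered_product :: "(nat \<Rightarrow> 'a::semigroup_mult) \<Rightarrow> nat \<Rightarrow> 'a" where
  "ordered_product f 0 = f 0"
| "ordered_product f (Suc k) = ordered_product f k * f (Suc k)"

definition relatively_dense :: "'k::semigroup_mult set \<Rightarrow> bool" where
  "relatively_dense E \<longleftrightarrow>
     (\<exists>r\<ge>1. \<exists>h :: nat \<Rightarrow> 'k. \<forall>g. E \<inter> (\<lambda>j. g * h j) ` {1..r} \<noteq> {})"

end

theory Submission
  imports Defs
begin

text \<open>
  Write \<open>|x|\<close> for the seminorm of \<open>\<omega>\<close>. By compactness, \<open>|\<tau> g A - A|\<close> is small for a relatively
  dense set of \<open>g\<close> (\<open>return_times_relatively_dense\<close>), and then so is \<open>|\<tau> (g^n) A - A|\<close> for each of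
  the finitely many exponents \<open>n\<close>, because \<open>\<tau>\<close> preserves the seminorm. All factors of the ordered
  product are bounded in norm by \<open>\<parallel>A\<parallel>\<close>, so replacing them one at a time by \<open>A\<close> changes the product
  little in the seminorm; this uses \<open>|x y| \<le> \<parallel>x\<parallel> |y|\<close> and, by the trace property,
  \<open>|x y| \<le> |x| \<parallel>y\<parallel>\<close>. Finally \<open>|\<omega> x| \<le> |x|\<close>, so the values in question are close to \<open>\<omega> (A^(k+1))\<close>,
  and it remains to see that this number is nonzero.

  The inequality \<open>|\<omega> x| \<le> |x|\<close> is not an instance of Cauchy-Schwarz, as there may be no unit; it needs
  an \<open>e\<close> with \<open>\<parallel>e\<parallel> \<le> 1\<close> and \<open>e x\<close> close to \<open>x\<close>. Such elements come from the resolvent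
  \<open>u = h (1 - i t h)\<^sup>-\<^sup>1\<close> of the self-adjoint element \<open>h = x x*\<close>: the identity \<open>u - u* = 2 i t u* u\<close>
  and the C*-identity give \<open>\<parallel>u\<parallel> \<le> 1 / t\<close> with no spectral theory, and \<open>e = - i t u\<close> satisfies
  \<open>h - e h = u\<close>.

  For the powers, the spectral hypothesis on \<open>A\<close> yields \<open>0 \<le> \<omega> (x* A x)\<close> for all \<open>x\<close>
  (\<open>positive_element_form_nonneg\<close>): if the operator \<open>A + s\<close> is positive and invertible, it is bounded
  below by a positive constant, so \<open>s\<close> can be lowered until it reaches \<open>0\<close>. Now descend: if \<open>\<omega>\<close>
  vanishes at \<open>A^(2i)\<close> then \<open>|A^i| = 0\<close>, and if it vanishes at \<open>A^(2i+1) = A^i A A^i\<close> with \<open>i \<ge> 1\<close>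
  then Cauchy-Schwarz for the form \<open>\<omega> (x* A y)\<close> gives \<open>|A^(i+1)| = 0\<close>. Either way \<open>\<omega>\<close> vanishes at
  a smaller power, and in the end at \<open>A\<close> itself.
\<close>

section \<open>Positive sesquilinear forms\<close>

locale positive_sesquilinear_form =
  fixes B :: "'a::star_algebra \<Rightarrow> 'a \<Rightarrow> complex"
  assumes add_left: "B (x + y) z = B x z + B y z"
    and add_right: "B x (y + z) = B x y + B x z"
    and scale_left: "B (c *\<^sub>C x) y = cnj c * B x y"
    and scale_right: "B x (c *\<^sub>C y) = c * B x y"
    and nonneg: "0 \<le> B x x"
begin

lemma expand: "B (x + c *\<^sub>C y) (x + c *\<^sub>C y) = B x x + c * B x y + cnj c * B y x + c * cnj c * B y y"
  by (simp add: add_left add_right scale_left scale_right algebra_simps)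

lemma diagonal_real: "Im (B x x) = 0" "0 \<le> Re (B x x)"
  using nonneg[of x] by (auto simp: less_eq_complex_def)

lemma hermitian: "B y x = cnj (B x y)"
proof -
  \<comment> \<open>The form is real on the diagonal; polarize with the coefficients 1 and \<open>\<i>\<close>.\<close>
  have "Im (B (x + c *\<^sub>C y) (x + c *\<^sub>C y)) = 0" for c
    by (rule diagonal_real)
  from this[of 1] this[of \<i>] have "Im (B x y) + Im (B y x) = 0" "Re (B x y) - Re (B y x) = 0"
    by (simp_all add: expand diagonal_real)
  then show ?thesis by (simp add: complex_eq_iff)
qed

lemma Cauchy_Schwarz: "(cmod (B x y))\<^sup>2 \<le> Re (B x x) * Re (B y y)"
proof -
  define b where "b = B x y"
  have *: "0 \<le> Re (B x x) - 2 * r * (cmod b)\<^sup>2 + r\<^sup>2 * (cmod b)\<^sup>2 * Re (B y y)" for r :: real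
  proof -
    define c where "c = - complex_of_real r * cnj b"
    have "0 \<le> Re (B (x + c *\<^sub>C y) (x + c *\<^sub>C y))" by (rule diagonal_real)
    also have "B (x + c *\<^sub>C y) (x + c *\<^sub>C y) = B x x + c * b + cnj c * cnj b + c * cnj c * B y y"
      by (simp only: expand hermitian[of y x] b_def)
    also have "Re \<dots> = Re (B x x) - 2 * r * (cmod b)\<^sup>2 + r\<^sup>2 * (cmod b)\<^sup>2 * Re (B y y)"
      using diagonal_real(1)[of y] unfolding c_def cmod_power2
      by (simp add: power2_eq_square algebra_simps)
    finally show ?thesis .
  qed
  show ?thesis
  proof (cases "Re (B y y) = 0")
    case True
    \<comment> \<open>The bound is then affine in \<open>r\<close>, so its slope cannot be negative.\<close>
    have "(cmod b)\<^sup>2 = 0"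
    proof (rule ccontr)
      assume "(cmod b)\<^sup>2 \<noteq> 0"
      with *[of "(Re (B x x) + 1) / (2 * (cmod b)\<^sup>2)"] True show False by simp
    qed
    then show ?thesis using True by (simp add: b_def)
  next
    case False
    with diagonal_real(2)[of y] have "Re (B y y) > 0" by simp
    with *[of "1 / Re (B y y)"] show ?thesis
      by (simp add: b_def field_simps power2_eq_square)
  qed
qed

end


section \<open>Elementary facts on star-algebras and C*-algebras\<close>

interpretation scaleC: vector_space "scaleC :: complex \<Rightarrow> 'a \<Rightarrow> 'a::star_algebra"
  by unfold_locales (simp_all add: scaleC_add_left scaleC_add_right scaleC_scaleC scaleC_one)

lemma star_diff: "star (x - y) = star x - star (y :: 'a::star_algebra)"
  using star_add[of "x - y" y] by (simp add: algebra_simps)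

lemma norm_star: "norm (star x) = norm (x :: 'a::cstar_algebra)"
proof -
  have le: "norm y \<le> norm (star y)" for y :: 'a
  proof (cases "norm y = 0")
    case False
    have "norm y * norm y \<le> norm (star y) * norm y"
      using norm_mult_ineq[of "star y" y] by (simp add: cstar_identity power2_eq_square)
    with False show ?thesis by simp
  qed simp
  show ?thesis using le[of x] le[of "star x"] by (simp add: star_star)
qed

lemma bounded_linear_scaleC: "bounded_linear (\<lambda>y::'a::cstar_algebra. w *\<^sub>C y)"
  by (rule bounded_linear_intro[where K = "cmod w"])
    (simp_all add: scaleC_add_right scaleR_scaleC scaleC_scaleC norm_scaleC mult.commute)

lemma bounded_linear_scaleC_mult:
  "bounded_linear (\<lambda>y. w *\<^sub>C (a * y))" "bounded_linear (\<lambda>y. w *\<^sub>C (y * a))" for a :: "'a::cstar_algebra"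
  by (intro bounded_linear_compose[OF bounded_linear_scaleC] bounded_linear_mult_left
    bounded_linear_mult_right)+


section \<open>Resolvents and left approximate units\<close>

text \<open>In the unitization this says \<open>u = h (1 - z h)\<^sup>-\<^sup>1\<close>. Unlike the inverse itself, this element lies
  in the algebra.\<close>

definition resolvent :: "complex \<Rightarrow> 'a \<Rightarrow> 'a::star_algebra \<Rightarrow> bool" where
  "resolvent z h u \<longleftrightarrow> u = h + z *\<^sub>C (h * u) \<and> u = h + z *\<^sub>C (u * h)"

text \<open>From \<open>1 - s u = (1 - (z + s) h) (1 - z h)\<^sup>-\<^sup>1\<close> one gets
  \<open>u (1 - s u)\<^sup>-\<^sup>1 = h (1 - (z + s) h)\<^sup>-\<^sup>1\<close>. So the Neumann series of \<open>u\<close> continues the resolvent of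
  \<open>h\<close> from \<open>z\<close> to a neighbourhood of \<open>z\<close>.\<close>

lemma resolvent_translate:
  assumes "resolvent z h u" "resolvent s u v"
  shows "resolvent (z + s) h v"
proof -
  have u1: "u = h + z *\<^sub>C (h * u)" and u2: "u = h + z *\<^sub>C (u * h)"
    and v1: "v = u + s *\<^sub>C (u * v)" and v2: "v = u + s *\<^sub>C (v * u)"
    using assms by (auto simp: resolvent_def)
  have hv: "h * v = h * u + s *\<^sub>C (h * u * v)"
    by (subst v1) (simp add: algebra_simps mult_scaleC_right)
  have vh: "v * h = u * h + s *\<^sub>C (v * u * h)"
    by (subst v2) (simp add: algebra_simps mult_scaleC_left)
  have "u * v = h * v + z *\<^sub>C (h * u * v)"
    by (subst u1) (simp add: algebra_simps mult_scaleC_left)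
  then have "v = u + s *\<^sub>C (h * v + z *\<^sub>C (h * u * v))"
    using v1 by metis
  also have "\<dots> = u + s *\<^sub>C (h * v) + s *\<^sub>C z *\<^sub>C (h * u * v)"
    by (simp add: scaleC_add_right algebra_simps)
  also have "\<dots> = h + z *\<^sub>C (h * u) + s *\<^sub>C (h * v) + z *\<^sub>C s *\<^sub>C (h * u * v)"
    using u1 by (simp add: mult.commute)
  also have "\<dots> = h + (z + s) *\<^sub>C (h * v)"
    by (simp add: hv scaleC_add_left scaleC_add_right algebra_simps)
  finally have 1: "v = h + (z + s) *\<^sub>C (h * v)" .
  have "v * u = v * h + z *\<^sub>C (v * u * h)"
    by (subst u2) (simp add: algebra_simps mult_scaleC_right)
  then have "v = u + s *\<^sub>C (v * h + z *\<^sub>C (v * u * h))"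
    using v2 by metis
  also have "\<dots> = u + s *\<^sub>C (v * h) + s *\<^sub>C z *\<^sub>C (v * u * h)"
    by (simp add: scaleC_add_right algebra_simps)
  also have "\<dots> = h + z *\<^sub>C (u * h) + s *\<^sub>C (v * h) + z *\<^sub>C s *\<^sub>C (v * u * h)"
    using u2 by (simp add: mult.commute)
  also have "\<dots> = h + (z + s) *\<^sub>C (v * h)"
    by (simp add: vh scaleC_add_left scaleC_add_right algebra_simps)
  finally show ?thesis using 1 by (simp add: resolvent_def)
qed

lemma resolvent_Neumann:
  fixes a :: "'a::cstar_algebra"
  assumes "cmod w * norm a < 1"
  shows "\<exists>u. resolvent w a u"
proof -
  define f where "f n = ((\<lambda>y. w *\<^sub>C (a * y)) ^^ n) a" for n
  have f0: "f 0 = a" and fS: "f (Suc n) = w *\<^sub>C (a * f n)" for n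
    by (simp_all add: f_def)
  have "a * f n = f n * a" for n
  proof (induction n)
    case (Suc n)
    have "a * f (Suc n) = w *\<^sub>C (a * (a * f n))" by (simp add: fS mult_scaleC_right)
    also have "\<dots> = w *\<^sub>C (a * (f n * a))" by (simp only: Suc)
    also have "\<dots> = f (Suc n) * a" by (simp only: fS mult_scaleC_left mult.assoc)
    finally show ?case .
  qed (simp add: f0)
  then have fS': "f (Suc n) = w *\<^sub>C (f n * a)" for n
    by (simp add: fS)
  have bound: "norm (f n) \<le> norm a * (cmod w * norm a) ^ n" for n
  proof (induction n)
    case (Suc n)
    have "norm (f (Suc n)) \<le> cmod w * (norm a * norm (f n))"
      by (simp add: fS norm_scaleC mult_left_mono norm_mult_ineq)
    also have "\<dots> \<le> cmod w * (norm a * (norm a * (cmod w * norm a) ^ n))"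
      by (intro mult_left_mono Suc) auto
    finally show ?case by (simp add: algebra_simps)
  qed (simp add: f0)
  have sum: "summable f"
    by (rule summable_comparison_test'[OF _ bound]) (use assms in \<open>simp add: summable_mult summable_geometric\<close>)
  have head: "suminf f = a + (\<Sum>n. f (Suc n))"
    using suminf_split_head[OF sum] by (simp add: f0)
  have 1: "(\<Sum>n. f (Suc n)) = w *\<^sub>C (a * suminf f)"
    using bounded_linear.suminf[OF bounded_linear_scaleC_mult(1) sum] by (simp add: fS)
  have 2: "(\<Sum>n. f (Suc n)) = w *\<^sub>C (suminf f * a)"
    using bounded_linear.suminf[OF bounded_linear_scaleC_mult(2) sum] by (simp add: fS')
  have "resolvent w a (suminf f)"
    unfolding resolvent_def by (rule conjI[OF head[unfolded 1] head[unfolded 2]])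
  then show ?thesis ..
qed

text \<open>The adjoint \<open>u*\<close> is the resolvent at the conjugate point \<open>- i t\<close>, so the resolvent identity reads
  \<open>u - u* = 2 i t u* u\<close>. Taking norms, \<open>2 t \<parallel>u\<parallel>\<^sup>2 \<le> 2 \<parallel>u\<parallel>\<close>.\<close>

lemma resolvent_imaginary_bound:
  fixes h :: "'a::cstar_algebra"
  assumes h: "star h = h" and res: "resolvent (\<i> * complex_of_real t) h u" and t: "t > 0"
  shows "t * norm u \<le> 1"
proof -
  define z where "z = \<i> * complex_of_real t"
  define v where "v = star u"
  have u: "u = h + z *\<^sub>C (h * u)" using res by (simp add: resolvent_def z_def)
  have v: "v = h - z *\<^sub>C (v * h)"
    using arg_cong[OF u, of star]
    by (simp add: v_def star_add star_scaleC star_mult h z_def scaleC.scale_minus_left)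
  have 1: "v * u = h * u - z *\<^sub>C (v * h * u)"
    by (subst v) (simp add: algebra_simps mult_scaleC_left)
  have 2: "v * u = v * h + z *\<^sub>C (v * h * u)"
    by (subst u) (simp add: algebra_simps mult_scaleC_right)
  have "(2 * z) *\<^sub>C (v * u) = z *\<^sub>C (v * u + v * u)"
    by (simp only: mult_2 scaleC_add_left scaleC_add_right)
  also have "v * u + v * u = (h * u - z *\<^sub>C (v * h * u)) + (v * h + z *\<^sub>C (v * h * u))"
    by (simp only: 1[symmetric] 2[symmetric])
  also have "z *\<^sub>C \<dots> = (h + z *\<^sub>C (h * u)) - (h - z *\<^sub>C (v * h))"
    by (simp add: scaleC_add_right scaleC.scale_right_diff_distrib)
  also have "\<dots> = u - v"
    by (simp only: u[symmetric] v[symmetric])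
  finally have eq: "(2 * z) *\<^sub>C (v * u) = u - v" .
  have "2 * t * (norm u)\<^sup>2 = norm ((2 * z) *\<^sub>C (v * u))"
    using t by (simp add: norm_scaleC v_def cstar_identity z_def norm_mult)
  also have "\<dots> \<le> 2 * norm u"
    unfolding eq using norm_triangle_ineq4[of u v] by (simp add: v_def norm_star)
  finally have "(t * norm u) * norm u \<le> 1 * norm u" by (simp add: power2_eq_square)
  then show ?thesis by (cases "norm u = 0") (auto simp: mult_le_cancel_right)
qed

text \<open>The a priori bound \<open>\<parallel>u\<parallel> \<le> 1 / t\<close> makes the Neumann series of \<open>u\<close> converge at every \<open>s\<close> with
  \<open>|s| < t\<close>. Hence a resolvent at \<open>i t\<close> leads to one at \<open>i (3/2) t\<close>, and these points escape to
  infinity.\<close>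

lemma resolvent_imaginary_exists:
  fixes h :: "'a::cstar_algebra"
  assumes h: "star h = h"
  shows "\<exists>t>T. \<exists>u. resolvent (\<i> * complex_of_real t) h u"
proof -
  define t0 where "t0 = 1 / (norm h + 1)"
  have t0: "t0 > 0" by (simp add: t0_def add_nonneg_pos)
  have ex: "\<exists>u. resolvent (\<i> * complex_of_real (t0 * (3/2) ^ n)) h u" for n
  proof (induction n)
    case 0
    have "t0 * norm h < 1" by (simp add: t0_def divide_less_eq add_nonneg_pos)
    then show ?case
      by (intro resolvent_Neumann) (use t0 in \<open>simp add: norm_mult\<close>)
  next
    case (Suc n)
    define t where "t = t0 * (3/2) ^ n"
    have t: "t > 0" by (simp add: t_def t0)
    from Suc obtain u where u: "resolvent (\<i> * complex_of_real t) h u" by (auto simp: t_def)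
    have "t * norm u \<le> 1" by (rule resolvent_imaginary_bound[OF h u t])
    then have "cmod (\<i> * complex_of_real (t/2)) * norm u < 1"
      using t by (simp add: norm_mult)
    then obtain v where "resolvent (\<i> * complex_of_real (t/2)) u v"
      using resolvent_Neumann by blast
    from resolvent_translate[OF u this]
    have "resolvent (\<i> * complex_of_real (t0 * (3/2) ^ Suc n)) h v"
      by (simp add: t_def algebra_simps flip: of_real_add)
    then show ?case ..
  qed
  obtain n where "T / t0 < (3/2) ^ n" using real_arch_pow[of "3/2" "T/t0"] by auto
  then have "T < t0 * (3/2) ^ n" using t0 by (simp add: field_simps)
  with ex[of n] show ?thesis by blast
qed

text \<open>With \<open>h = x x*\<close> and \<open>e = - z u\<close> the resolvent equation says \<open>h - e h = u\<close>, which is small. This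
  passes to \<open>x\<close> because \<open>(x - e x) (x - e x)* = u - u e*\<close>.\<close>

lemma left_approximate_unit:
  fixes x :: "'a::cstar_algebra"
  assumes \<epsilon>: "\<epsilon> > 0"
  shows "\<exists>e. norm e \<le> 1 \<and> norm (x - e * x) \<le> \<epsilon>"
proof -
  define h where "h = x * star x"
  have h: "star h = h" by (simp add: h_def star_mult star_star)
  obtain t u where t: "t > 2 / \<epsilon>\<^sup>2" and u: "resolvent (\<i> * complex_of_real t) h u"
    using resolvent_imaginary_exists[OF h] by blast
  have t0: "t > 0" using t \<epsilon> by (meson divide_pos_pos less_trans zero_less_numeral zero_less_power)
  have tu: "t * norm u \<le> 1" by (rule resolvent_imaginary_bound[OF h u t0])
  define z where "z = \<i> * complex_of_real t"
  define e where "e = - (z *\<^sub>C u)"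
  define y where "y = x - e * x"
  have ne: "norm e \<le> 1" using tu t0 by (simp add: e_def z_def norm_scaleC norm_mult)
  have eh: "h - e * h = u"
    using u by (simp add: resolvent_def e_def z_def mult_scaleC_left)
  have "(norm y)\<^sup>2 = norm (y * star y)"
    using cstar_identity[of "star y"] by (simp add: star_star norm_star)
  also have "y * star y = (h - e * h) - (h - e * h) * star e"
    by (simp add: y_def h_def star_diff star_mult algebra_simps)
  also have "norm \<dots> \<le> norm u + norm u * norm e"
    unfolding eh by (rule order_trans[OF norm_triangle_ineq4]) (metis add_left_mono norm_mult_ineq norm_star)
  also have "\<dots> \<le> 2 * norm u" using ne mult_left_le[of "norm e" "norm u"] by simp
  also have "\<dots> \<le> \<epsilon>\<^sup>2"
  proof -
    have "norm u \<le> 1 / t" using tu t0 by (simp add: field_simps)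
    moreover have "2 / t \<le> \<epsilon>\<^sup>2" using t t0 \<epsilon> by (simp add: field_simps)
    ultimately show ?thesis by simp
  qed
  finally have "norm y \<le> \<epsilon>" using \<epsilon> by (simp add: power2_le_iff_abs_le)
  then show ?thesis using ne by (auto simp: y_def)
qed


lemma le_of_power_two_power_le:
  fixes a b :: real
  assumes a: "0 \<le> a" and b: "0 \<le> b" and le: "\<And>n. a ^ 2 ^ n \<le> C * b ^ 2 ^ n"
  shows "a \<le> b"
proof (rule ccontr)
  assume "\<not> a \<le> b"
  then have ab: "b < a" by simp
  show False
  proof (cases "b = 0")
    case True
    with le[of 0] ab show False by simp
  next
    case False
    with b have b0: "b > 0" by simp
    with ab have "1 < a / b" by simp
    then obtain n where n: "C < (a / b) ^ n" using real_arch_pow by blast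
    also have "(a / b) ^ n \<le> (a / b) ^ 2 ^ n"
      using \<open>1 < a / b\<close> by (intro power_increasing) (simp_all add: less_imp_le)
    finally have "C * b ^ 2 ^ n < a ^ 2 ^ n"
      using b0 by (simp add: power_divide less_divide_eq)
    with le[of n] show False by simp
  qed
qed


section \<open>The seminorm of a positive functional\<close>

locale contractive_positive_functional =
  fixes \<omega> :: "'a::cstar_algebra \<Rightarrow> complex"
  assumes positive: "positive_functional \<omega>"
    and contractive: "cmod (\<omega> x) \<le> norm x"
begin

abbreviation seminorm :: "'a \<Rightarrow> real" where
  "seminorm \<equiv> functional_seminorm \<omega>"

lemma linear_simps: "\<omega> (x + y) = \<omega> x + \<omega> y" "\<omega> (c *\<^sub>C x) = c * \<omega> x" "\<omega> (x - y) = \<omega> x - \<omega> y"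
proof -
  have lin: "Vector_Spaces.linear scaleC (*) \<omega>" using positive by (simp add: positive_functional_def)
  show add: "\<omega> (x + y) = \<omega> x + \<omega> y" for x y
    by (rule Vector_Spaces.linear.axioms(3)[OF lin, THEN module_hom.add])
  show "\<omega> (c *\<^sub>C x) = c * \<omega> x"
    by (rule Vector_Spaces.linear.axioms(3)[OF lin, THEN module_hom.scale])
  show "\<omega> (x - y) = \<omega> x - \<omega> y" using add[of "x - y" y] by simp
qed

sublocale inner: positive_sesquilinear_form "\<lambda>x y. \<omega> (star x * y)"
  by unfold_locales
    (use positive in \<open>simp_all add: positive_functional_def star_add star_scaleC linear_simps
      algebra_simps mult_scaleC_left mult_scaleC_right\<close>)

lemma seminorm_nonneg: "0 \<le> seminorm x"
  using inner.diagonal_real by (simp add: functional_seminorm_def)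

lemma seminorm_power2: "(seminorm x)\<^sup>2 = Re (\<omega> (star x * x))"
  using inner.diagonal_real by (simp add: functional_seminorm_def)

lemma seminorm_Cauchy_Schwarz: "cmod (\<omega> (star x * y)) \<le> seminorm x * seminorm y"
  by (rule power2_le_imp_le)
    (use inner.Cauchy_Schwarz[of x y] in
      \<open>simp_all add: power_mult_distrib seminorm_power2 seminorm_nonneg\<close>)

lemma seminorm_le_norm: "seminorm x \<le> norm x"
proof (rule power2_le_imp_le)
  have "Re (\<omega> (star x * x)) \<le> norm (star x * x)"
    by (rule order_trans[OF complex_Re_le_cmod contractive])
  then show "(seminorm x)\<^sup>2 \<le> (norm x)\<^sup>2" by (simp add: seminorm_power2 cstar_identity)
qed simp

lemma seminorm_triangle: "seminorm (x + y) \<le> seminorm x + seminorm y"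
proof (rule power2_le_imp_le)
  have "(seminorm (x + y))\<^sup>2 =
      (seminorm x)\<^sup>2 + Re (\<omega> (star x * y)) + Re (\<omega> (star y * x)) + (seminorm y)\<^sup>2"
    by (simp add: seminorm_power2 star_add linear_simps algebra_simps)
  also have "\<dots> \<le> (seminorm x)\<^sup>2 + seminorm x * seminorm y + seminorm y * seminorm x + (seminorm y)\<^sup>2"
    by (intro add_mono order_refl order_trans[OF complex_Re_le_cmod seminorm_Cauchy_Schwarz])
  finally show "(seminorm (x + y))\<^sup>2 \<le> (seminorm x + seminorm y)\<^sup>2"
    by (simp add: power2_sum)
qed (simp add: seminorm_nonneg)

lemma seminorm_scaleC: "seminorm (c *\<^sub>C x) = cmod c * seminorm x"
proof (rule power2_eq_imp_eq)
  have "\<omega> (star (c *\<^sub>C x) * (c *\<^sub>C x)) = (c * cnj c) * \<omega> (star x * x)"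
    by (simp add: star_scaleC linear_simps mult_scaleC_left mult_scaleC_right)
  also have "c * cnj c = complex_of_real ((cmod c)\<^sup>2)"
    using complex_norm_square[of c] by simp
  finally show "(seminorm (c *\<^sub>C x))\<^sup>2 = (cmod c * seminorm x)\<^sup>2"
    by (simp add: seminorm_power2 power_mult_distrib)
qed (simp_all add: seminorm_nonneg)

lemma seminorm_zero: "seminorm 0 = 0"
  using seminorm_scaleC[of 0 0] by simp

lemma seminorm_minus_commute: "seminorm (x - y) = seminorm (y - x)"
  using seminorm_scaleC[of "-1" "x - y"] by (simp add: scaleC.scale_minus_left)

text \<open>Put \<open>r n = |h^n x| / |x|\<close>. As \<open>h\<close> is self-adjoint, Cauchy-Schwarz gives \<open>(r n)\<^sup>2 \<le> r (2 n)\<close>, so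
  \<open>(r 1)^N \<le> r N \<le> (\<parallel>x\<parallel> / |x|) \<parallel>h\<parallel>^N\<close> whenever \<open>N\<close> is a power of two. The constant
  disappears as \<open>N\<close> grows. This replaces the order relation \<open>h\<^sup>2 \<le> \<parallel>h\<parallel>\<^sup>2\<close> in the unitization.\<close>

lemma seminorm_mult_selfadjoint:
  assumes h: "star h = h"
  shows "seminorm (h * x) \<le> norm h * seminorm x"
proof -
  define p where "p n = ((*) h ^^ n) x" for n
  have pS: "p (Suc n) = h * p n" for n by (simp add: p_def)
  have shift: "star (p (m + k)) * p n = star (p m) * p (n + k)" for m n k
  proof (induction k arbitrary: n)
    case (Suc k)
    have "star (p (m + Suc k)) * p n = star (p (m + k)) * p (Suc n)"
      by (simp add: pS star_mult h mult.assoc)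
    then show ?case by (simp add: Suc)
  qed simp
  have norm_p: "norm (p n) \<le> norm h ^ n * norm x" for n
  proof (induction n)
    case (Suc n)
    have "norm (p (Suc n)) \<le> norm h * norm (p n)" by (simp add: pS norm_mult_ineq)
    also have "\<dots> \<le> norm h * (norm h ^ n * norm x)" by (intro mult_left_mono Suc) auto
    finally show ?case by simp
  qed (simp add: p_def)
  have double: "(seminorm (p n))\<^sup>2 \<le> seminorm x * seminorm (p (2 * n))" for n
  proof -
    have "(seminorm (p n))\<^sup>2 = Re (\<omega> (star x * p (2 * n)))"
      using shift[of 0 n n] by (simp add: seminorm_power2 mult_2) (simp add: p_def)
    also have "\<dots> \<le> seminorm x * seminorm (p (2 * n))"
      by (rule order_trans[OF complex_Re_le_cmod seminorm_Cauchy_Schwarz])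
    finally show ?thesis .
  qed
  show ?thesis
  proof (cases "seminorm x = 0")
    case True
    with double[of 1] show ?thesis by (simp add: p_def)
  next
    case False
    with seminorm_nonneg[of x] have x: "seminorm x > 0" by simp
    have iter: "(seminorm (h * x) / seminorm x) ^ 2 ^ n \<le> seminorm (p (2 ^ n)) / seminorm x" for n
    proof (induction n)
      case 0
      show ?case by (simp add: p_def)
    next
      case (Suc n)
      have "(seminorm (h * x) / seminorm x) ^ 2 ^ Suc n = ((seminorm (h * x) / seminorm x) ^ 2 ^ n)\<^sup>2"
        by (simp add: power_even_eq)
      also have "\<dots> \<le> (seminorm (p (2 ^ n)) / seminorm x)\<^sup>2"
        by (intro power_mono Suc) (simp add: seminorm_nonneg)
      also have "\<dots> \<le> seminorm (p (2 ^ Suc n)) / seminorm x"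
        using double[of "2 ^ n"] x by (simp add: power_divide field_simps power2_eq_square)
      finally show ?case .
    qed
    have "seminorm (h * x) / seminorm x \<le> norm h"
    proof (rule le_of_power_two_power_le)
      fix n :: nat
      have "seminorm (p (2 ^ n)) \<le> norm h ^ 2 ^ n * norm x"
        by (rule order_trans[OF seminorm_le_norm norm_p])
      with iter[of n] x
      show "(seminorm (h * x) / seminorm x) ^ 2 ^ n \<le> (norm x / seminorm x) * norm h ^ 2 ^ n"
        by (smt (verit) divide_right_mono mult.commute times_divide_eq_left)
    qed (simp_all add: seminorm_nonneg)
    then show ?thesis using x by (simp add: field_simps)
  qed
qed

lemma seminorm_mult_left: "seminorm (b * x) \<le> norm b * seminorm x"
proof (rule power2_le_imp_le)
  have "(seminorm (b * x))\<^sup>2 = Re (\<omega> (star x * ((star b * b) * x)))"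
    by (simp add: seminorm_power2 star_mult mult.assoc)
  also have "\<dots> \<le> seminorm x * seminorm ((star b * b) * x)"
    by (rule order_trans[OF complex_Re_le_cmod seminorm_Cauchy_Schwarz])
  also have "\<dots> \<le> seminorm x * (norm (star b * b) * seminorm x)"
    by (intro mult_left_mono seminorm_mult_selfadjoint) (simp_all add: star_mult star_star seminorm_nonneg)
  finally show "(seminorm (b * x))\<^sup>2 \<le> (norm b * seminorm x)\<^sup>2"
    by (simp add: cstar_identity power2_eq_square algebra_simps)
qed (simp add: seminorm_nonneg)

text \<open>In a unital algebra this would be Cauchy-Schwarz against the unit; a left approximate unit for
  the single element \<open>x\<close> takes its place.\<close>

lemma functional_le_seminorm: "cmod (\<omega> x) \<le> seminorm x"
proof (rule field_le_epsilon)
  fix \<epsilon> :: real assume "\<epsilon> > 0"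
  then obtain e where e: "norm e \<le> 1" "norm (x - e * x) \<le> \<epsilon>"
    using left_approximate_unit by blast
  have "\<omega> x = \<omega> (star (star e) * x) + \<omega> (x - e * x)"
    by (simp add: linear_simps star_star)
  then have "cmod (\<omega> x) \<le> cmod (\<omega> (star (star e) * x)) + cmod (\<omega> (x - e * x))"
    by (simp only: norm_triangle_ineq)
  also have "\<dots> \<le> seminorm (star e) * seminorm x + \<epsilon>"
    by (intro add_mono seminorm_Cauchy_Schwarz order_trans[OF contractive e(2)])
  also have "seminorm (star e) * seminorm x \<le> 1 * seminorm x"
    using e(1) seminorm_le_norm[of "star e"]
    by (intro mult_right_mono) (simp_all add: norm_star seminorm_nonneg)
  finally show "cmod (\<omega> x) \<le> seminorm x + \<epsilon>" by simp
qed


section \<open>Positive elements act as positive operators\<close>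

text \<open>This turns nonnegativity of the quadratic form of \<open>A + s\<close> into Cauchy-Schwarz for that form.\<close>

lemma shifted_form:
  assumes A: "star A = A" and nonneg: "\<And>x. 0 \<le> Re (\<omega> (star x * (A * x))) + s * (seminorm x)\<^sup>2"
  shows "positive_sesquilinear_form (\<lambda>x y. \<omega> (star x * (A * y)) + complex_of_real s * \<omega> (star x * y))"
proof
  fix x :: 'a
  have "\<omega> (star x * (A * x)) = cnj (\<omega> (star x * (A * x)))"
    using inner.hermitian[of "A * x" x] by (simp add: star_mult A mult.assoc)
  then have "Im (\<omega> (star x * (A * x))) = 0" by (metis Reals_cnj_iff complex_is_Real_iff)
  then show "0 \<le> \<omega> (star x * (A * x)) + complex_of_real s * \<omega> (star x * x)"
    using nonneg[of x] inner.diagonal_real[of x] by (simp add: less_eq_complex_def seminorm_power2)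
qed (simp_all add: star_add star_scaleC linear_simps algebra_simps mult_scaleC_left mult_scaleC_right)

end

text \<open>Invertibility of \<open>A + s\<close> in the unitization, expressed by the resolvent at \<open>-1 / s\<close>.\<close>

lemma positive_element_resolvent:
  assumes "A \<in> positive_elements" "s > 0"
  shows "\<exists>u. resolvent (- complex_of_real (1 / s)) A u"
proof -
  define c where "c = - complex_of_real s"
  have c: "c \<noteq> 0" using assms(2) by (simp add: c_def)
  have "c \<notin> cstar_spectrum A"
    using assms by (auto simp: positive_elements_def c_def less_eq_complex_def)
  then obtain q where "unitization_mult (c, - A) q = (1, 0)" "unitization_mult q (c, - A) = (1, 0)"
    by (auto simp: cstar_spectrum_def)
  moreover obtain d v where q: "q = (d, v)" by force
  ultimately have d: "d = 1 / c" and v: "c *\<^sub>C v = d *\<^sub>C A + A * v" "c *\<^sub>C v = d *\<^sub>C A + v * A"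
    using c by (auto simp: unitization_mult_def field_simps scaleC.scale_minus_right algebra_simps
        add_eq_0_iff)
  define u where "u = c *\<^sub>C (c *\<^sub>C v)"
  have "u = A + (1 / c) *\<^sub>C (A * u)"
    by (subst u_def, subst v(1)) (simp add: u_def d c scaleC_add_right mult_scaleC_right)
  moreover have "u = A + (1 / c) *\<^sub>C (u * A)"
    by (subst u_def, subst v(2)) (simp add: u_def d c scaleC_add_right mult_scaleC_left)
  ultimately show ?thesis by (auto simp: resolvent_def c_def)
qed


context contractive_positive_functional
begin

text \<open>Consider the least \<open>s0 \<ge> 0\<close> for which the form of \<open>T = A + s0\<close> is nonnegative. If \<open>s0 > 0\<close>, then
  \<open>T\<close> has a bounded inverse, so \<open>|x| \<le> M |T x|\<close>. Cauchy-Schwarz for the form of \<open>T\<close>, applied to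
  \<open>x\<close> and \<open>y = T x\<close>, gives \<open>|T x|\<^sup>2 \<le> (\<parallel>A\<parallel> + s0) q\<close> with \<open>q\<close> the value of the form at \<open>x\<close>.
  Together, \<open>|x|\<^sup>2 \<le> K q\<close>, so the form of \<open>A + s0 - 1 / K\<close> is still nonnegative, contradicting
  the choice of \<open>s0\<close>. In this way the spectrum, a statement about invertibility only, controls the
  sign of the form.\<close>

lemma positive_element_form_nonneg:
  assumes A: "A \<in> positive_elements"
  shows "0 \<le> Re (\<omega> (star x * (A * x)))"
proof -
  have sA: "star A = A" using A by (simp add: positive_elements_def)
  define good where "good s \<longleftrightarrow> (\<forall>x. 0 \<le> Re (\<omega> (star x * (A * x))) + s * (seminorm x)\<^sup>2)" for s
  have form_bound: "\<bar>Re (\<omega> (star x * (A * x)))\<bar> \<le> norm A * (seminorm x)\<^sup>2" for x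
  proof -
    have "\<bar>Re (\<omega> (star x * (A * x)))\<bar> \<le> seminorm x * seminorm (A * x)"
      by (rule order_trans[OF abs_Re_le_cmod seminorm_Cauchy_Schwarz])
    also have "\<dots> \<le> seminorm x * (norm A * seminorm x)"
      by (intro mult_left_mono seminorm_mult_left seminorm_nonneg)
    finally show ?thesis by (simp add: power2_eq_square algebra_simps)
  qed
  have good_norm: "good (norm A)" unfolding good_def using form_bound by (smt (verit))
  have good_mono: "good t" if "good s" "s \<le> t" for s t
    unfolding good_def
  proof
    fix x
    have "s * (seminorm x)\<^sup>2 \<le> t * (seminorm x)\<^sup>2" using that(2) by (intro mult_right_mono) auto
    with that(1) show "0 \<le> Re (\<omega> (star x * (A * x))) + t * (seminorm x)\<^sup>2"
      unfolding good_def by (smt (verit))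
  qed
  define S where "S = {s. 0 \<le> s \<and> good s}"
  define s0 where "s0 = Inf S"
  have S: "norm A \<in> S" "bdd_below S"
    unfolding S_def bdd_below_def using good_norm by auto
  have s0: "0 \<le> s0" unfolding s0_def
  proof (rule cInf_greatest)
    show "S \<noteq> {}" using S(1) by blast
  qed (simp add: S_def)
  have good_s0: "good s0" unfolding good_def
  proof
    fix x
    show "0 \<le> Re (\<omega> (star x * (A * x))) + s0 * (seminorm x)\<^sup>2"
    proof (cases "seminorm x = 0")
      case True
      then show ?thesis using form_bound[of x] by simp
    next
      case False
      then have pos: "(seminorm x)\<^sup>2 > 0" by simp
      have "- Re (\<omega> (star x * (A * x))) / (seminorm x)\<^sup>2 \<le> s0"
        unfolding s0_def
      proof (rule cInf_greatest)
        fix s assume "s \<in> S"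
        then have "0 \<le> Re (\<omega> (star x * (A * x))) + s * (seminorm x)\<^sup>2" by (auto simp: S_def good_def)
        then show "- Re (\<omega> (star x * (A * x))) / (seminorm x)\<^sup>2 \<le> s"
          unfolding pos_divide_le_eq[OF pos] by simp
      qed (use S(1) in auto)
      then show ?thesis unfolding pos_divide_le_eq[OF pos] by simp
    qed
  qed
  have "s0 = 0"
  proof (rule ccontr)
    assume "s0 \<noteq> 0"
    with s0 have s0_pos: "s0 > 0" by simp
    obtain u where u: "resolvent (- complex_of_real (1 / s0)) A u"
      using positive_element_resolvent[OF A s0_pos] by blast
    define z where "z = - complex_of_real (1 / s0)"
    define M where "M = (1 + norm u / s0) / s0"
    define K where "K = M\<^sup>2 * (norm A + s0)"
    interpret shifted: positive_sesquilinear_form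
      "\<lambda>x y. \<omega> (star x * (A * y)) + complex_of_real s0 * \<omega> (star x * y)"
      by (rule shifted_form[OF sA]) (use good_s0 in \<open>simp add: good_def\<close>)
    have "M > 0"
      unfolding M_def using s0_pos by (intro divide_pos_pos add_pos_nonneg) auto
    then have K: "K > 0"
      unfolding K_def using s0_pos by (intro mult_pos_pos add_nonneg_pos) auto
    have coercive: "(seminorm x)\<^sup>2 \<le> K * (Re (\<omega> (star x * (A * x))) + s0 * (seminorm x)\<^sup>2)" for x
    proof -
      define q where "q = Re (\<omega> (star x * (A * x))) + s0 * (seminorm x)\<^sup>2"
      define y where "y = A * x + complex_of_real s0 *\<^sub>C x"
      have q0: "q \<ge> 0" using good_s0 by (simp add: q_def good_def)
      \<comment> \<open>In the unitization, \<open>1 + z u\<close> is the inverse of \<open>1 - z A = T / s0\<close>.\<close>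
      have xy: "x = complex_of_real (1 / s0) *\<^sub>C (y + z *\<^sub>C (u * y))"
      proof -
        define w where "w = x - z *\<^sub>C (A * x)"
        have yw: "complex_of_real (1 / s0) *\<^sub>C y = w"
          using s0_pos
          by (simp add: y_def w_def z_def scaleC_add_right scaleC_scaleC scaleC_one
              scaleC.scale_minus_left)
        have "u = A + z *\<^sub>C (u * A)" using u by (simp add: resolvent_def z_def)
        then have "u * x = A * x + z *\<^sub>C (u * A * x)"
          by (metis distrib_right mult_scaleC_left)
        then have "u * w = A * x"
          by (simp add: w_def right_diff_distrib mult_scaleC_right mult.assoc)
        then have "x = w + z *\<^sub>C (u * w)" by (simp add: w_def)
        also have "\<dots> = complex_of_real (1 / s0) *\<^sub>C (y + z *\<^sub>C (u * y))"
          unfolding yw[symmetric]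
          by (simp add: scaleC_add_right mult_scaleC_right scaleC_scaleC mult.commute)
        finally show ?thesis .
      qed
      have "seminorm x = (1 / s0) * seminorm (y + z *\<^sub>C (u * y))"
        using s0_pos by (subst xy) (simp add: seminorm_scaleC norm_divide)
      also have "seminorm (y + z *\<^sub>C (u * y)) \<le> seminorm y + (1 / s0) * (norm u * seminorm y)"
      proof -
        have "seminorm (z *\<^sub>C (u * y)) = (1 / s0) * seminorm (u * y)"
          using s0_pos by (simp only: seminorm_scaleC) (simp add: z_def norm_divide)
        also have "\<dots> \<le> (1 / s0) * (norm u * seminorm y)"
          using s0_pos by (intro mult_left_mono seminorm_mult_left) simp
        finally show ?thesis using seminorm_triangle[of y "z *\<^sub>C (u * y)"] by simp
      qed
      finally have xM: "seminorm x \<le> M * seminorm y"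
        using s0_pos by (simp add: M_def field_simps)
      have "star y = star x * A + complex_of_real s0 *\<^sub>C star x"
        by (simp add: y_def star_add star_mult star_scaleC sA)
      then have "\<omega> (star x * (A * y)) + complex_of_real s0 * \<omega> (star x * y) = \<omega> (star y * y)"
        by (simp add: linear_simps distrib_right mult_scaleC_left mult.assoc)
      moreover have "(seminorm y)\<^sup>2 \<le> cmod (\<omega> (star y * y))"
        unfolding seminorm_power2 by (rule complex_Re_le_cmod)
      ultimately have "((seminorm y)\<^sup>2)\<^sup>2 \<le>
          (cmod (\<omega> (star x * (A * y)) + complex_of_real s0 * \<omega> (star x * y)))\<^sup>2"
        by (intro power_mono) simp_all
      also have "\<dots> \<le> q * (Re (\<omega> (star y * (A * y))) + s0 * (seminorm y)\<^sup>2)"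
        using shifted.Cauchy_Schwarz[of x y] by (simp add: q_def seminorm_power2)
      also have "\<dots> \<le> q * ((norm A + s0) * (seminorm y)\<^sup>2)"
        using form_bound[of y] q0 by (intro mult_left_mono) (simp_all add: distrib_right)
      finally have yqy: "(seminorm y)\<^sup>2 * (seminorm y)\<^sup>2 \<le> (q * (norm A + s0)) * (seminorm y)\<^sup>2"
        by (simp add: power2_eq_square algebra_simps)
      have yq: "(seminorm y)\<^sup>2 \<le> q * (norm A + s0)"
      proof (cases "seminorm y = 0")
        case True
        then show ?thesis using q0 s0 by simp
      next
        case False
        then have "0 < (seminorm y)\<^sup>2" by simp
        with yqy show ?thesis by (rule mult_right_le_imp_le)
      qed
      have "(seminorm x)\<^sup>2 \<le> (M * seminorm y)\<^sup>2"
        by (intro power_mono xM seminorm_nonneg)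
      also have "\<dots> \<le> M\<^sup>2 * (q * (norm A + s0))"
        using yq by (simp add: power_mult_distrib mult_left_mono)
      finally show ?thesis by (simp add: K_def q_def algebra_simps)
    qed
    have "good (s0 - 1 / K)"
      unfolding good_def
    proof
      fix x
      show "0 \<le> Re (\<omega> (star x * (A * x))) + (s0 - 1 / K) * (seminorm x)\<^sup>2"
        using coercive[of x] K by (simp add: field_simps)
    qed
    then have "max 0 (s0 - 1 / K) \<in> S" by (auto simp: S_def intro: good_mono)
    then have "s0 \<le> max 0 (s0 - 1 / K)" unfolding s0_def by (rule cInf_lower[OF _ S(2)])
    with s0_pos K show False by (auto simp: max_def split: if_splits)
  qed
  with good_s0 show ?thesis by (simp add: good_def)
qed

text \<open>The product with last index \<open>n\<close> has \<open>n + 1\<close> factors, so odd \<open>n\<close> are the even powers. For an even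
  power \<open>P n = P j * P j\<close> the seminorm of \<open>P j\<close> vanishes together with \<open>\<omega> (P n)\<close>; for an odd power
  \<open>P n = P j * A * P j\<close> the element \<open>P j\<close> is null for the form \<open>\<omega> (x* A y)\<close>, and pairing it with
  \<open>P (j + 1) = A * P j\<close> shows that the latter has seminorm zero.\<close>

lemma functional_power_nonzero:
  assumes A: "A \<in> positive_elements" and nz: "\<omega> A \<noteq> 0"
  shows "\<omega> (ordered_product (\<lambda>_. A) n) \<noteq> 0"
proof -
  define P where "P = ordered_product (\<lambda>_. A)"
  have sA: "star A = A" using A by (simp add: positive_elements_def)
  have P0: "P 0 = A" and PS: "P (Suc n) = P n * A" for n by (simp_all add: P_def)
  have P_add: "P i * P j = P (Suc (i + j))" for i j
    by (induction j) (simp_all add: P0 PS flip: mult.assoc)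
  have PS': "A * P n = P (Suc n)" for n using P_add[of 0 n] by (simp add: P0)
  have sP: "star (P n) = P n" for n
    by (induction n) (simp_all add: P0 PS sA star_mult, metis PS PS')
  have null: "\<omega> (P i) = 0" if "seminorm (P i) = 0" for i
    using functional_le_seminorm[of "P i"] that by simp
  interpret form: positive_sesquilinear_form
    "\<lambda>x y. \<omega> (star x * (A * y)) + complex_of_real 0 * \<omega> (star x * y)"
    by (rule shifted_form[OF sA]) (simp add: positive_element_form_nonneg[OF A])
  have "\<omega> (P n) \<noteq> 0"
  proof (induction n rule: less_induct)
    case (less n)
    consider "n = 0" | j where "n = Suc (j + j)" | j where "n = Suc (Suc (j + j))"
      by (metis add_Suc_right not0_implies_Suc oddE evenE mult_2 Suc_eq_plus1 add_Suc)
    then show ?case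
    proof cases
      case 1
      then show ?thesis using nz by (simp add: P0)
    next
      case 2
      show ?thesis
      proof
        assume "\<omega> (P n) = 0"
        then have "seminorm (P j) = 0" by (simp add: functional_seminorm_def sP P_add 2)
        with null less[of j] 2 show False by simp
      qed
    next
      case 3
      show ?thesis
      proof
        assume "\<omega> (P n) = 0"
        then have "\<omega> (star (P j) * (A * P j)) = 0" by (simp add: sP P_add PS' 3)
        then have "\<omega> (star (P (Suc j)) * (A * P j)) = 0"
          using form.Cauchy_Schwarz[of "P (Suc j)" "P j"] by simp
        then have "seminorm (P (Suc j)) = 0" by (simp add: functional_seminorm_def PS')
        with null less[of "Suc j"] 3 show False by simp
      qed
    qed
  qed
  then show ?thesis by (simp add: P_def)
qed

end


section \<open>Ordered products under a trace\<close>

locale contractive_positive_trace = contractive_positive_functional +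
  assumes trace: "\<omega> (x * y) = \<omega> (y * x)"
begin

lemma seminorm_star: "seminorm (star x) = seminorm x"
  by (simp add: functional_seminorm_def star_star trace[of x])

lemma seminorm_mult_right: "seminorm (x * y) \<le> seminorm x * norm y"
  using seminorm_mult_left[of "star y" "star x"] seminorm_star[of "x * y"]
  by (simp add: star_mult seminorm_star norm_star mult.commute)

lemma seminorm_ordered_product_diff:
  assumes f: "\<And>j. norm (f j) \<le> c" and g: "\<And>j. norm (g j) \<le> c"
    and close: "\<And>j. j \<le> n \<Longrightarrow> seminorm (f j - g j) \<le> \<delta>"
  shows "seminorm (ordered_product f n - ordered_product g n) \<le> real (Suc n) * c ^ n * \<delta>"
  using close
proof (induction n)
  case 0
  then show ?case by simp
next
  case (Suc n)
  define F G where "F = ordered_product f n" and "G = ordered_product g n"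
  have c: "0 \<le> c" using f[of 0] norm_ge_zero[of "f 0"] by linarith
  have G: "norm G \<le> c ^ Suc n" unfolding G_def
  proof (induction n)
    case (Suc n)
    have "norm (ordered_product g n * g (Suc n)) \<le> c ^ Suc n * c"
      by (rule order_trans[OF norm_mult_ineq]) (intro mult_mono Suc g, use c in auto)
    then show ?case by (simp add: mult.commute)
  qed (simp add: g)
  have IH: "seminorm (F - G) \<le> real (Suc n) * c ^ n * \<delta>"
    unfolding F_def G_def using Suc by simp
  have "ordered_product f (Suc n) - ordered_product g (Suc n) =
      (F - G) * f (Suc n) + G * (f (Suc n) - g (Suc n))"
    by (simp add: F_def G_def algebra_simps)
  then have "seminorm (ordered_product f (Suc n) - ordered_product g (Suc n)) \<le>
      seminorm ((F - G) * f (Suc n)) + seminorm (G * (f (Suc n) - g (Suc n)))"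
    by (simp only: seminorm_triangle)
  also have "\<dots> \<le> seminorm (F - G) * norm (f (Suc n)) + norm G * seminorm (f (Suc n) - g (Suc n))"
    by (intro add_mono seminorm_mult_left seminorm_mult_right)
  also have "\<dots> \<le> (real (Suc n) * c ^ n * \<delta>) * c + c ^ Suc n * \<delta>"
    by (intro add_mono mult_mono IH f G Suc.prems order_refl) 
      (use c order_trans[OF seminorm_nonneg IH] in \<open>auto simp: seminorm_nonneg\<close>)
  finally show ?case by (simp add: algebra_simps)
qed

end


section \<open>Return times\<close>

text \<open>Let \<open>S\<close> be an \<open>\<epsilon>\<close>-separated set of largest size in the orbit together with \<open>x\<close>. Its image under
  any \<open>T g\<close> is again separated and of the same size, so \<open>x\<close> cannot be added to it: some \<open>T g s\<close> is
  \<open>\<epsilon>\<close>-close to \<open>x\<close>. In a group one would instead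
  compare \<open>T h x\<close> with \<open>T (g\<^sup>-\<^sup>1) x\<close>.\<close>

lemma return_times_relatively_dense:
  fixes d :: "'x \<Rightarrow> 'x \<Rightarrow> real" and T :: "'k::semigroup_mult \<Rightarrow> 'x \<Rightarrow> 'x"
  assumes refl: "\<And>y. d y y = 0" and sym: "\<And>y z. d y z = d z y"
    and triangle: "\<And>y z w. d y w \<le> d y z + d z w"
    and isometric: "\<And>g y z. d (T g y) (T g z) = d y z"
    and action: "\<And>g h y. T g (T h y) = T (g * h) y"
    and tb: "pseudometric_totally_bounded d (range (\<lambda>g. T g x))"
    and \<epsilon>: "\<epsilon> > 0"
  shows "relatively_dense {g. d (T g x) x < \<epsilon>}"
proof -
  define X where "X = insert x (range (\<lambda>g. T g x))"
  define separated where "separated S \<longleftrightarrow> S \<subseteq> X \<and> (\<forall>y\<in>S. \<forall>z\<in>S. y \<noteq> z \<longrightarrow> \<epsilon> \<le> d y z)" for S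
  have TX: "T g y \<in> X" if "y \<in> X" for g y using that by (auto simp: X_def action)
  obtain M0 where M0: "finite M0" "\<And>y. y \<in> range (\<lambda>g. T g x) \<Longrightarrow> \<exists>z\<in>M0. d y z < \<epsilon> / 2"
    using tb \<epsilon> unfolding pseudometric_totally_bounded_def by (meson half_gt_zero)
  define M where "M = insert x M0"
  have M: "finite M" "\<exists>z\<in>M. d y z < \<epsilon> / 2" if "y \<in> X" for y
    using M0 that \<epsilon> by (auto simp: M_def X_def refl)
  have xX: "x \<in> X" by (simp add: X_def)
  have bounded: "finite S \<and> card S \<le> card M" if "separated S" for S
  proof -
    have "\<forall>y\<in>S. \<exists>z\<in>M. d y z < \<epsilon> / 2" using M that by (auto simp: separated_def)
    then obtain n where n: "\<And>y. y \<in> S \<Longrightarrow> n y \<in> M \<and> d y (n y) < \<epsilon> / 2" by metis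
    have "inj_on n S"
    proof (rule inj_onI, rule ccontr)
      fix y z assume yz: "y \<in> S" "z \<in> S" "n y = n z" "y \<noteq> z"
      have "d y z \<le> d y (n y) + d (n y) z" by (rule triangle)
      also have "\<dots> < \<epsilon>" using n[OF yz(1)] n[OF yz(2)] yz(3) sym[of "n y" z] by simp
      finally have "d y z < \<epsilon>" .
      moreover have "\<epsilon> \<le> d y z" using that yz by (simp add: separated_def)
      ultimately show False by simp
    qed
    moreover have "n ` S \<subseteq> M" using n by auto
    ultimately show ?thesis
      using M(1)[OF xX] by (meson card_inj_on_le finite_subset inj_on_finite)
  qed
  have "separated {}" by (simp add: separated_def)
  then have "\<exists>S. separated S \<and> (\<forall>S'. separated S' \<longrightarrow> card S' \<le> card S)"
    by (rule ex_has_greatest_nat[where b = "Suc (card M)"]) (use bounded in \<open>auto simp: less_Suc_eq_le\<close>)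
  then obtain S where S: "separated S" and max: "\<And>S'. separated S' \<Longrightarrow> card S' \<le> card S"
    by metis
  have S_sub: "S \<subseteq> X" and S_sep: "\<And>y z. y \<in> S \<Longrightarrow> z \<in> S \<Longrightarrow> y \<noteq> z \<Longrightarrow> \<epsilon> \<le> d y z"
    using S by (auto simp: separated_def)
  have finS: "finite S" using bounded[OF S] by simp
  have near: "\<exists>s\<in>S. d (T g s) x < \<epsilon>" for g
  proof (rule ccontr)
    assume "\<not> ?thesis"
    then have far: "\<And>s. s \<in> S \<Longrightarrow> \<epsilon> \<le> d (T g s) x" by force
    have inj: "inj_on (T g) S"
    proof (rule inj_onI, rule ccontr)
      fix y z assume "y \<in> S" "z \<in> S" "T g y = T g z" "y \<noteq> z"
      then show False using S_sep[of y z] isometric[of g y z] refl \<epsilon> by simp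
    qed
    have "separated (insert x (T g ` S))"
      using far S_sub S_sep TX sym xX by (auto simp: separated_def isometric)
    then have "card (insert x (T g ` S)) \<le> card S" by (rule max)
    moreover have "x \<notin> T g ` S" using far refl \<epsilon> by force
    ultimately show False using finS by (simp add: card_image[OF inj])
  qed
  \<comment> \<open>As \<open>x\<close> may belong to \<open>S\<close> without lying in the orbit, the elements of \<open>S\<close> are first moved into
    the orbit by an arbitrary fixed \<open>h\<close>; then \<open>T (g * h) s\<close> has the form \<open>T (g * \<kappa> s) x\<close>.\<close>
  obtain h :: 'k where True by simp
  have "\<forall>s\<in>S. \<exists>k. \<forall>g. T (g * h) s = T (g * k) x"
  proof
    fix s assume "s \<in> S"
    with S_sub consider "s = x" | k where "s = T k x" by (auto simp: X_def)
    then show "\<exists>k. \<forall>g. T (g * h) s = T (g * k) x"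
      by cases (auto simp: action mult.assoc)
  qed
  then obtain \<kappa> where \<kappa>: "\<And>s g. s \<in> S \<Longrightarrow> T (g * h) s = T (g * \<kappa> s) x" by metis
  define H where "H = \<kappa> ` S"
  have "finite H" by (simp add: H_def finS)
  then obtain e where "bij_betw e {1..card H} H" using ex_bij_betw_nat_finite_1 by blast
  then have e: "e ` {1..card H} = H" by (simp add: bij_betw_def)
  have "H \<noteq> {}" using near by (auto simp: H_def)
  then have "card H \<ge> 1" using \<open>finite H\<close> by (simp add: Suc_le_eq card_gt_0_iff)
  moreover have "{g. d (T g x) x < \<epsilon>} \<inter> (\<lambda>j. g * e j) ` {1..card H} \<noteq> {}" for g
  proof -
    obtain s where s: "s \<in> S" "d (T (g * h) s) x < \<epsilon>" using near by blast
    then have "\<kappa> s \<in> e ` {1..card H}" unfolding e by (simp add: H_def)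
    then obtain j where j: "j \<in> {1..card H}" "e j = \<kappa> s" by force
    have "g * e j \<in> {g. d (T g x) x < \<epsilon>}" using s j(2) \<kappa>[OF s(1), of g] by simp
    then show ?thesis using j(1) by blast
  qed
  ultimately show ?thesis unfolding relatively_dense_def by blast
qed


section \<open>Multiple recurrence\<close>

context star_dynamical_system
begin

lemma map_diff: "\<tau> g (x - y) = \<tau> g x - \<tau> g y"
proof -
  have "\<tau> g (a + b) = \<tau> g a + \<tau> g b" for a b
    by (rule Vector_Spaces.linear.axioms(3)[OF linear, THEN module_hom.add])
  from this[of "x - y" y] show ?thesis by simp
qed

end

lemma (in cstar_dynamical_system) norm_action_power_le: "norm (action_power \<tau> g n x) \<le> norm x"
  by (cases n) (simp_all add: norm_contractive)

lemma (in cstar_dynamical_system) seminorm_action_power_diff: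
  assumes "contractive_positive_functional \<omega>"
  shows "functional_seminorm \<omega> (action_power \<tau> g n x - x) \<le> real n * functional_seminorm \<omega> (\<tau> g x - x)"
proof -
  interpret contractive_positive_functional \<omega> by fact
  show ?thesis
  proof (induction n)
    case 0
    show ?case by (simp add: seminorm_zero)
  next
    case (Suc n)
    show ?case
    proof (cases n)
      case (Suc i)
      define p where "p = semigroup_power_Suc g i"
      have "action_power \<tau> g (Suc n) x - x = \<tau> p (\<tau> g x - x) + (\<tau> p x - x)"
        using fun_cong[OF action[of p g], of x] by (simp add: Suc p_def map_diff)
      then have "functional_seminorm \<omega> (action_power \<tau> g (Suc n) x - x) \<le>
          functional_seminorm \<omega> (\<tau> p (\<tau> g x - x)) + functional_seminorm \<omega> (\<tau> p x - x)"
        by (simp only: seminorm_triangle)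
      then show ?thesis
        using Suc.IH by (simp add: Suc p_def seminorm_preserving algebra_simps)
    qed simp
  qed
qed

theorem corollary4p2:
  fixes \<omega> :: "'a::cstar_algebra \<Rightarrow> complex"
    and \<tau> :: "'k::semigroup_mult \<Rightarrow> 'a \<Rightarrow> 'a"
    and A :: 'a
    and k :: nat
    and m :: "nat \<Rightarrow> nat"
  assumes "cstar_dynamical_system \<omega> \<tau>"
    and "compact_system \<omega> \<tau>"
    and "trace_state \<omega>"
    and "A \<in> positive_elements"
    and "0 < \<omega> A"
  shows "\<exists>(E :: 'k set) (a :: real). relatively_dense E \<and> a > 0 \<and>
           (\<forall>g\<in>E. cmod (\<omega> (ordered_product (\<lambda>j. action_power \<tau> g (m j) A) k)) > a)"
proof -
  interpret cstar_dynamical_system \<omega> \<tau> by fact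
  interpret contractive_positive_trace \<omega>
  proof
    have st: "state \<omega>" using assms(3) by (simp add: trace_state_def)
    then show "positive_functional \<omega>" by (simp add: state_def)
    show "cmod (\<omega> x) \<le> norm x" for x
      using onorm[of \<omega> x] st by (simp add: state_def)
    show "\<omega> (x * y) = \<omega> (y * x)" for x y using assms(3) by (simp add: trace_state_def)
  qed
  define p where "p = ordered_product (\<lambda>_. A) k"
  define N where "N = Max (m ` {..k})"
  define C where "C = real (Suc k) * norm A ^ k * real N"
  define a where "a = cmod (\<omega> p) / 2"
  \<comment> \<open>This makes \<open>C * \<epsilon> < a\<close>, even if \<open>C = 0\<close>.\<close>
  define \<epsilon> where "\<epsilon> = a / (C + 1)"
  have "\<omega> p \<noteq> 0"
    unfolding p_def using functional_power_nonzero[OF assms(4)] assms(5) by auto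
  then have a: "a > 0" by (simp add: a_def)
  have C: "C \<ge> 0" by (simp add: C_def)
  have \<epsilon>: "\<epsilon> > 0" using a C by (simp add: \<epsilon>_def)
  have dense: "relatively_dense {g. seminorm (\<tau> g A - A) < \<epsilon>}"
  proof (rule return_times_relatively_dense[where d = "\<lambda>y z. seminorm (y - z)"])
    show "seminorm (y - z) = seminorm (z - y)" for y z by (rule seminorm_minus_commute)
    show "seminorm (y - w) \<le> seminorm (y - z) + seminorm (z - w)" for y z w
      using seminorm_triangle[of "y - z" "z - w"] by simp
    show "seminorm (\<tau> g y - \<tau> g z) = seminorm (y - z)" for g y z
      using seminorm_preserving[of g "y - z"] by (simp add: map_diff)
    show "\<tau> g (\<tau> h y) = \<tau> (g * h) y" for g h y using fun_cong[OF action[of g h], of y] by simp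
    show "pseudometric_totally_bounded (\<lambda>y z. seminorm (y - z)) (range (\<lambda>g. \<tau> g A))"
      using assms(2) by (simp add: compact_system_def)
  qed (simp_all add: seminorm_zero \<epsilon>)
  have large: "a < cmod (\<omega> (ordered_product (\<lambda>j. action_power \<tau> g (m j) A) k))"
    if g: "seminorm (\<tau> g A - A) < \<epsilon>" for g
  proof -
    define q where "q = ordered_product (\<lambda>j. action_power \<tau> g (m j) A) k"
    have "seminorm (action_power \<tau> g (m j) A - A) \<le> real N * \<epsilon>" if "j \<le> k" for j
    proof -
      have "seminorm (action_power \<tau> g (m j) A - A) \<le> real (m j) * seminorm (\<tau> g A - A)"
        by (rule seminorm_action_power_diff) (rule contractive_positive_functional_axioms)
      also have "\<dots> \<le> real N * \<epsilon>"
        using that g by (intro mult_mono) (auto simp: N_def seminorm_nonneg)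
      finally show ?thesis .
    qed
    then have "seminorm (q - p) \<le> real (Suc k) * norm A ^ k * (real N * \<epsilon>)"
      unfolding p_def q_def
      by (intro seminorm_ordered_product_diff norm_action_power_le order_refl)
    then have "cmod (\<omega> q - \<omega> p) \<le> C * \<epsilon>"
      using functional_le_seminorm[of "q - p"] by (simp add: C_def linear_simps mult.assoc)
    also have "\<dots> < a" using a C by (simp add: \<epsilon>_def field_simps)
    finally have "cmod (\<omega> q - \<omega> p) < a" .
    moreover have "cmod (\<omega> p) \<le> cmod (\<omega> q) + cmod (\<omega> q - \<omega> p)"
      using norm_triangle_ineq4[of "\<omega> q" "\<omega> q - \<omega> p"] by simp
    ultimately show ?thesis unfolding q_def[symmetric] by (simp add: a_def)
  qed
  show ?thesis
    using dense a large by blast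
qed

end
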